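(* Let $\alpha$ be a rational number with $0<\alpha\leq \frac12$. Then the function $x\mapsto F^{(2)}_{\alpha,1}(-x)=\sum_{r=0}^{\infty}\frac{(-x)^{r}}{[\Gamma(1+\alpha r)]^{2}}$ is completely monotone on $(0,\infty)$.
   Context: For $\alpha>0$, $\beta\in\mathbb{R}$ and a positive integer $n$, the Mittag-Leffler function of Le Roy type is the entire function $F^{(n)}_{\alpha,\beta}(z)=\sum_{r=0}^{\infty} \frac{z^{r}}{[\Gamma(\beta+\alpha r)]^{n}}$. A function $f:(0,\infty)\to\mathbb{R}$ is completely monotone if it is infinitely differentiable and $(-1)^{j}f^{(j)}(x)\geq 0$ for all $x>0$ and all $j=0,1,2,\ldots$, where $f^{(j)}$ is the $j$-th derivative. *)

theory Defs
  imports "HOL-Analysis.Analysis"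
begin

(* The type variable 'a covers both the entire function (complex) and its restriction
   to the real line (real).  At a pole of Gamma the library has Gamma = 0, so for n > 0
   the corresponding term is z ^ r / 0 = 0, in agreement with 1 / Gamma = 0 there. *)
definition le_roy_ML :: "nat \<Rightarrow> real \<Rightarrow> real \<Rightarrow> 'a::{real_normed_field,banach} \<Rightarrow> 'a" where
  "le_roy_ML n \<alpha> \<beta> z = (\<Sum>r. z ^ r / of_real (Gamma (\<beta> + \<alpha> * real r) ^ n))"

(* Since (0, \<infinity>) is open, the iterated derivatives at x > 0 depend only on the
   restriction of f to (0, \<infinity>); the values of f elsewhere are irrelevant. *)
definition completely_monotone :: "(real \<Rightarrow> real) \<Rightarrow> bool" where
  "completely_monotone f \<longleftrightarrow>
     (\<forall>j. \<forall>x>0. (deriv ^^ j) f differentiable (at x)) \<and>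
     (\<forall>j. \<forall>x>0. (-1) ^ j * (deriv ^^ j) f x \<ge> 0)"

end

(* If r! / Gamma(1 + \<alpha> r)^2 is the r-th moment of a measure M on [0, \<infinity>), then
   F(-x) is the integral of exp(-x t) dM(t), hence completely monotone.
   For \<alpha> = p/q put u = r/q.  Gauss's multiplication formula, applied to Gamma(1 + q u) and
   Gamma(1 + p u), turns the quotient into c * a^r times the product of Gamma(u + k/q), k = 1..q,
   divided by the product of Gamma(u + j/p)^2, j = 1..p.  Listed with multiplicity, the k-th of
   the 2p denominator parameters is \<lceil>k/2\<rceil>/p \<ge> k/(2p) \<ge> k/q because 2p \<le> q, so each denominator
   factor pairs with a numerator factor to a ratio that is a moment of a power of a beta
   variable; the unpaired numerator factors are moments of powers of gamma variables.
   Moment sequences are closed under products. *)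

theory Submission
  imports Defs
begin

section \<open>Logarithmic convexity and Gauss's multiplication formula\<close>

lemma convex_on_eq:
  assumes "convex_on S f" "\<And>x. x \<in> S \<Longrightarrow> f x = g x"
  shows "convex_on S g"
  using assms unfolding convex_on_def by (metis convexD)

lemma convex_on_ln_prod:
  fixes f :: "'i \<Rightarrow> real \<Rightarrow> real"
  assumes "finite I" "convex S"
    and "\<And>i. i \<in> I \<Longrightarrow> convex_on S (ln \<circ> f i)"
    and "\<And>i x. i \<in> I \<Longrightarrow> x \<in> S \<Longrightarrow> f i x > 0"
  shows "convex_on S (ln \<circ> (\<lambda>x. \<Prod>i\<in>I. f i x))"
  using assms
proof (induction I rule: finite_induct)
  case empty
  then show ?case by (simp add: convex_on_def o_def)
next
  case (insert i I)
  have "convex_on S (\<lambda>x. (ln \<circ> f i) x + (ln \<circ> (\<lambda>x. \<Prod>i\<in>I. f i x)) x)"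
    using insert by (intro convex_on_add) auto
  moreover have "(ln \<circ> f i) x + (ln \<circ> (\<lambda>x. \<Prod>i\<in>I. f i x)) x
      = (ln \<circ> (\<lambda>x. \<Prod>i\<in>insert i I. f i x)) x" if "x \<in> S" for x
    using insert that by (simp add: ln_mult_pos prod_pos)
  ultimately show ?case
    by (rule convex_on_eq)
qed

lemma convex_on_ln_Gamma_affine:
  fixes a c :: real
  assumes "a \<ge> 0" "c > 0"
  shows "convex_on {0<..} (ln \<circ> (\<lambda>y. Gamma ((y + a) / c)))"
proof (rule convex_onI)
  fix t x y :: real
  assume *: "0 < t" "t < 1" "x \<in> {0<..}" "y \<in> {0<..}"
  have "(ln \<circ> Gamma) ((1 - t) *\<^sub>R ((x + a) / c) + t *\<^sub>R ((y + a) / c))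
      \<le> (1 - t) * (ln \<circ> Gamma) ((x + a) / c) + t * (ln \<circ> Gamma) ((y + a) / c)"
    using * assms by (intro convex_onD[OF log_convex_Gamma_real]) auto
  moreover have "(1 - t) *\<^sub>R ((x + a) / c) + t *\<^sub>R ((y + a) / c) = ((1 - t) *\<^sub>R x + t *\<^sub>R y + a) / c"
    using assms by (simp add: field_simps)
  ultimately show "(ln \<circ> (\<lambda>y. Gamma ((y + a) / c))) ((1 - t) *\<^sub>R x + t *\<^sub>R y)
      \<le> (1 - t) * (ln \<circ> (\<lambda>y. Gamma ((y + a) / c))) x + t * (ln \<circ> (\<lambda>y. Gamma ((y + a) / c))) y"
    by simp
qed simp

text \<open>By Bohr-Mollerup: the right-hand side is 1 at 1, satisfies the functional equation of
  Gamma and is log-convex. Dividing by the value of the product at \<open>y = 1\<close> avoids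
  evaluating the classical constant (2 pi)^((p-1)/2) / sqrt p.\<close>

theorem Gamma_multiplication_real:
  fixes y :: real
  assumes p: "p > 0" and y: "y > 0"
  shows "Gamma y = real p powr (y - 1) * (\<Prod>k<p. Gamma ((y + real k) / real p))
                     / (\<Prod>k<p. Gamma ((1 + real k) / real p))"
proof -
  define C where "C = (\<Prod>k<p. Gamma ((1 + real k) / real p))"
  define P where "P = (\<lambda>y. \<Prod>k<p. Gamma ((y + real k) / real p))"
  define G where "G = (\<lambda>y. real p powr (y - 1) * P y / C)"
  have C: "C > 0"
    unfolding C_def using p by (intro prod_pos Gamma_real_pos) auto
  have P: "P x > 0" if "x > 0" for x
    unfolding P_def using p that by (intro prod_pos ballI Gamma_real_pos) auto
  have "G y = Gamma y"
  proof (rule Gamma_pos_real_unique)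
    show "G 1 = 1"
    proof -
      have "P 1 = C" by (simp add: P_def C_def)
      then show ?thesis using C p by (simp add: G_def)
    qed
    show "G x > 0" if "x > 0" for x
      using P[OF that] C p by (simp add: G_def)
    show "G (x + 1) = x * G x" if x: "x > 0" for x
    proof -
      \<comment> \<open>Passing from \<open>x\<close> to \<open>x + 1\<close> drops the factor
        \<open>k = 0\<close> and gains the factor \<open>k = p\<close>; the product of
        \<open>p + 1\<close> factors contains both.\<close>
      have "Gamma (x / real p) * P (x + 1) = (\<Prod>k<Suc p. Gamma ((x + real k) / real p))"
        unfolding P_def by (subst prod.lessThan_Suc_shift) (simp add: add_ac)
      also have "\<dots> = P x * Gamma (x / real p + 1)"
        unfolding P_def using p by (simp add: field_simps)
      also have "Gamma (x / real p + 1) = x / real p * Gamma (x / real p)"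
      proof (rule Gamma_plus1)
        have "x / real p > 0" using x p by simp
        then show "x / real p \<notin> \<int>\<^sub>\<le>\<^sub>0" by (auto dest: nonpos_Ints_nonpos)
      qed
      finally have "Gamma (x / real p) * P (x + 1) = Gamma (x / real p) * (x / real p * P x)"
        by simp
      moreover have "Gamma (x / real p) > 0"
        using x p by (intro Gamma_real_pos) auto
      ultimately have "P (x + 1) = x / real p * P x"
        by (metis mult_cancel_left less_irrefl)
      moreover have "real p powr x = real p * real p powr (x - 1)"
        using p by (simp add: powr_diff)
      ultimately show ?thesis
        using p by (simp add: G_def)
    qed
    show "convex_on {0<..} (ln \<circ> G)"
    proof -
      have "convex_on {0<..} (ln \<circ> P)"
        unfolding P_def using p
        by (intro convex_on_ln_prod convex_on_ln_Gamma_affine Gamma_real_pos) auto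
      \<comment> \<open>The remaining factor \<open>p powr (x - 1) / C\<close> has an affine
        logarithm.\<close>
      moreover have "convex_on {0<..} (\<lambda>x. x * ln (real p) + (- ln (real p) - ln C))"
        by (rule convex_onI) (auto simp: algebra_simps)
      ultimately have "convex_on {0<..} (\<lambda>x. (ln \<circ> P) x + (x * ln (real p) + (- ln (real p) - ln C)))"
        by (rule convex_on_add)
      moreover have "(ln \<circ> P) x + (x * ln (real p) + (- ln (real p) - ln C)) = (ln \<circ> G) x"
        if "x \<in> {0<..}" for x
        using P[of x] C p that
        by (simp add: G_def ln_div ln_mult_pos ln_powr algebra_simps)
      ultimately show ?thesis
        by (rule convex_on_eq)
    qed
  qed (fact y)
  then show ?thesis
    by (simp add: G_def P_def C_def)
qed

section \<open>Stieltjes moment sequences and their closure properties\<close>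

text \<open>\<open>ennreal\<close> sends negative reals to 0, hence the explicit sign conditions on
  \<open>t\<close> and \<open>m n\<close>: with them the identity is one between real moments. Its
  case \<open>n = 0\<close> makes \<open>M\<close> a finite measure.\<close>

definition stieltjes_moment_seq :: "(nat \<Rightarrow> real) \<Rightarrow> bool" where
  "stieltjes_moment_seq m \<longleftrightarrow>
     (\<exists>M :: real measure. sets M = sets borel \<and> (AE t in M. 0 \<le> t) \<and>
        (\<forall>n. 0 \<le> m n \<and> (\<integral>\<^sup>+t. ennreal (t ^ n) \<partial>M) = ennreal (m n)))"

text \<open>These are the moments of a point mass of weight \<open>c\<close> at \<open>a\<close>,
  obtained by mapping a weighted one-point space into the line.\<close>

lemma stieltjes_moment_seq_geometric:
  assumes "a \<ge> 0" "c \<ge> 0"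
  shows "stieltjes_moment_seq (\<lambda>n. c * a ^ n)"
proof -
  define M where "M = distr (density (count_space {()}) (\<lambda>_. ennreal c)) borel (\<lambda>_. a)"
  have "(\<integral>\<^sup>+t. ennreal (t ^ n) \<partial>M) = ennreal (c * a ^ n)" for n
    using assms unfolding M_def
    by (simp add: nn_integral_distr emeasure_density nn_integral_count_space_finite
        ennreal_mult mult.commute)
  moreover have "AE t in M. 0 \<le> t"
    unfolding M_def using assms by (subst AE_distr_iff) auto
  ultimately show ?thesis
    unfolding stieltjes_moment_seq_def using assms
    by (intro exI[of _ M]) (auto simp: M_def)
qed

text \<open>As for a product of independent random variables: the product measure is pushed forward
  under multiplication, and Tonelli splits the integral.\<close>

lemma stieltjes_moment_seq_mult:
  assumes "stieltjes_moment_seq a" "stieltjes_moment_seq b"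
  shows "stieltjes_moment_seq (\<lambda>n. a n * b n)"
proof -
  obtain M where M: "sets M = sets borel" "AE t in M. 0 \<le> t" "\<And>n. 0 \<le> a n"
      "\<And>n. (\<integral>\<^sup>+t. ennreal (t ^ n) \<partial>M) = ennreal (a n)"
    using assms(1) unfolding stieltjes_moment_seq_def by blast
  obtain N where N: "sets N = sets borel" "AE t in N. 0 \<le> t" "\<And>n. 0 \<le> b n"
      "\<And>n. (\<integral>\<^sup>+t. ennreal (t ^ n) \<partial>N) = ennreal (b n)"
    using assms(2) unfolding stieltjes_moment_seq_def by blast
  note [measurable_cong] = M(1) N(1)
  \<comment> \<open>The zeroth moment is the total mass; its finiteness supplies the
    sigma-finiteness of \<open>N\<close> used by Tonelli.\<close>
  have "emeasure N (space N) = ennreal (b 0)"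
    using N(4)[of 0] by simp
  then interpret N: finite_measure N
    by (intro finite_measureI) simp
  \<comment> \<open>The absolute values make the support condition for \<open>L\<close> hold pointwise.\<close>
  define L where "L = distr (M \<Otimes>\<^sub>M N) borel (\<lambda>(x, y). \<bar>x\<bar> * \<bar>y\<bar>)"
  have abs_M: "(\<integral>\<^sup>+x. ennreal (\<bar>x\<bar> ^ n) \<partial>M) = ennreal (a n)" for n
    unfolding M(4)[symmetric] using M(2) by (intro nn_integral_cong_AE) auto
  have abs_N: "(\<integral>\<^sup>+x. ennreal (\<bar>x\<bar> ^ n) \<partial>N) = ennreal (b n)" for n
    unfolding N(4)[symmetric] using N(2) by (intro nn_integral_cong_AE) auto
  have "(\<integral>\<^sup>+t. ennreal (t ^ n) \<partial>L) = ennreal (a n * b n)" for n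
  proof -
    have "(\<integral>\<^sup>+t. ennreal (t ^ n) \<partial>L) = (\<integral>\<^sup>+z. ennreal ((\<bar>fst z\<bar> * \<bar>snd z\<bar>) ^ n) \<partial>(M \<Otimes>\<^sub>M N))"
      unfolding L_def by (simp add: nn_integral_distr case_prod_beta)
    also have "\<dots> = (\<integral>\<^sup>+x. \<integral>\<^sup>+y. ennreal ((\<bar>x\<bar> * \<bar>y\<bar>) ^ n) \<partial>N \<partial>M)"
      by (subst N.nn_integral_fst[symmetric]) simp_all
    also have "\<dots> = (\<integral>\<^sup>+x. \<integral>\<^sup>+y. ennreal (\<bar>x\<bar> ^ n) * ennreal (\<bar>y\<bar> ^ n) \<partial>N \<partial>M)"
      by (simp add: power_mult_distrib ennreal_mult)
    also have "\<dots> = (\<integral>\<^sup>+x. ennreal (\<bar>x\<bar> ^ n) * ennreal (b n) \<partial>M)"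
      by (subst nn_integral_cmult) (simp_all add: abs_N)
    also have "\<dots> = ennreal (a n) * ennreal (b n)"
      by (subst nn_integral_multc) (simp_all add: abs_M)
    finally show ?thesis
      using M(3) N(3) by (simp add: ennreal_mult)
  qed
  moreover have "AE t in L. 0 \<le> t"
    unfolding L_def by (subst AE_distr_iff) auto
  ultimately show ?thesis
    unfolding stieltjes_moment_seq_def using M(3) N(3)
    by (intro exI[of _ L]) (auto simp: L_def)
qed

lemma stieltjes_moment_seq_prod:
  assumes "finite I" "\<And>i. i \<in> I \<Longrightarrow> stieltjes_moment_seq (m i)"
  shows "stieltjes_moment_seq (\<lambda>n. \<Prod>i\<in>I. m i n)"
  using assms
proof (induction I rule: finite_induct)
  case empty
  then show ?case using stieltjes_moment_seq_geometric[of 1 1] by simp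
next
  case (insert i I)
  then show ?case by (simp add: stieltjes_moment_seq_mult)
qed

text \<open>Because \<open>0 powr a = 0\<close> even for \<open>a = 0\<close>, the case \<open>t = 0\<close> needs no null-set argument.\<close>

lemma stieltjes_moment_seq_mellin:
  fixes g :: "real \<Rightarrow> real"
  assumes g[measurable]: "g \<in> borel_measurable borel" and S[measurable]: "S \<in> sets borel"
    and nonneg: "\<And>t. t \<in> S \<Longrightarrow> 0 \<le> g t"
    and int: "\<And>n. ((\<lambda>t. t powr (b + s * real n - 1) * g t) has_integral m n) S"
  shows "stieltjes_moment_seq m"
proof -
  \<comment> \<open>Pushing the density \<open>t powr (b - 1) * g t\<close> on \<open>S\<close>
    forward under \<open>t powr s\<close> turns the \<open>n\<close>-th moment into the Mellin
    transform of \<open>g\<close> at \<open>b + s * n\<close>.\<close>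
  define w where "w = (\<lambda>t. indicator S t * (t powr (b - 1) * g t))"
  define M where "M = distr (density lborel (\<lambda>t. ennreal (w t))) borel (\<lambda>t. t powr s)"
  have [measurable]: "w \<in> borel_measurable borel"
    unfolding w_def by measurable
  have w: "w t \<ge> 0" for t
    using nonneg by (auto simp: w_def indicator_def)
  have "(\<integral>\<^sup>+t. ennreal (t ^ n) \<partial>M) = ennreal (m n)" for n
  proof -
    have eq: "w t * (t powr s) ^ n = indicator S t * (t powr (b + s * real n - 1) * g t)" for t
    proof (cases "t = 0")
      case False
      then have "(t powr s) ^ n = t powr (s * real n)"
        by (simp add: powr_powr flip: powr_realpow)
      moreover have "t powr (b + s * real n - 1) = t powr (b - 1) * t powr (s * real n)"
        by (simp add: algebra_simps flip: powr_add)
      ultimately show ?thesis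
        by (simp add: w_def)
    qed (simp add: w_def)
    have "(\<integral>\<^sup>+t. ennreal (t ^ n) \<partial>M) = (\<integral>\<^sup>+t. ennreal (w t) * ennreal ((t powr s) ^ n) \<partial>lborel)"
      unfolding M_def by (simp add: nn_integral_distr nn_integral_density)
    also have "\<dots> = (\<integral>\<^sup>+t. ennreal (indicator S t * (t powr (b + s * real n - 1) * g t)) \<partial>lborel)"
      using w by (simp add: ennreal_mult[symmetric] eq)
    also have "\<dots> = ennreal (m n)"
      using nonneg by (intro nn_integral_has_integral_lebesgue int) simp
    finally show ?thesis .
  qed
  moreover have "AE t in M. 0 \<le> t"
    unfolding M_def by (subst AE_distr_iff) auto
  moreover have "0 \<le> m n" for n
    using nonneg by (intro has_integral_nonneg[OF int]) simp
  ultimately show ?thesis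
    unfolding stieltjes_moment_seq_def
    by (intro exI[of _ M]) (auto simp: M_def)
qed

section \<open>Gamma values and Gamma quotients as moments\<close>

text \<open>Euler's integral exhibits Gamma as the Mellin transform of \<open>exp (- t)\<close> on
  the half-line.\<close>

lemma stieltjes_moment_seq_Gamma:
  assumes "b > 0" "s \<ge> 0"
  shows "stieltjes_moment_seq (\<lambda>n. Gamma (b + s * real n))"
proof (rule stieltjes_moment_seq_mellin[where S = "{0..}" and b = b and s = s and g = "\<lambda>t. 1 / exp t"])
  show "((\<lambda>t. t powr (b + s * real n - 1) * (1 / exp t)) has_integral Gamma (b + s * real n)) {0..}" for n
    using Gamma_integral_real[of "b + s * real n"] assms by (simp add: add_pos_nonneg)
qed auto

text \<open>\<open>Beta (b + s * n) (c - b)\<close> is a Mellin transform of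
  \<open>(1 - t) powr (c - b - 1)\<close> on [0, 1], and it equals the quotient times the constant
  \<open>Gamma (c - b)\<close>.\<close>

lemma stieltjes_moment_seq_Gamma_ratio:
  assumes "0 < b" "b \<le> c" "s \<ge> 0"
  shows "stieltjes_moment_seq (\<lambda>n. Gamma (b + s * real n) / Gamma (c + s * real n))"
\<comment> \<open>For \<open>b = c\<close> the Beta integral diverges, but the quotient is
  constantly 1 and belongs to the unit mass at 1.\<close>
proof (cases "b = c")
  case True
  have "Gamma (b + s * real n) \<noteq> 0" for n
    using assms by (intro less_imp_neq[THEN not_sym] Gamma_real_pos add_pos_nonneg) auto
  then show ?thesis
    using True stieltjes_moment_seq_geometric[of 1 1] by simp
next
  case False
  with assms have d: "c - b > 0" by simp
  have "stieltjes_moment_seq (\<lambda>n. Beta (b + s * real n) (c - b))"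
  proof (rule stieltjes_moment_seq_mellin[where S = "{0..1}" and b = b and s = s
        and g = "\<lambda>t. (1 - t) powr (c - b - 1)"])
    show "((\<lambda>t. t powr (b + s * real n - 1) * (1 - t) powr (c - b - 1))
             has_integral Beta (b + s * real n) (c - b)) {0..1}" for n
      using d assms by (intro has_integral_Beta_real) (auto simp: add_pos_nonneg)
  qed auto
  from stieltjes_moment_seq_mult[OF stieltjes_moment_seq_geometric[of 1 "1 / Gamma (c - b)"] this]
  show ?thesis
    using Gamma_real_pos[OF d] by (simp add: Beta_def add_ac)
qed

section \<open>The moment sequence for a rational parameter\<close>

lemma stieltjes_moment_seq_fact_div_Gamma_power2:
  fixes p q :: nat
  assumes p: "p > 0" and q: "2 * p \<le> q"
  shows "stieltjes_moment_seq (\<lambda>r. fact r / Gamma (1 + real p / real q * real r) ^ 2)"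
proof -
  define Cp where "Cp = (\<Prod>k<p. Gamma ((1 + real k) / real p))"
  define Cq where "Cq = (\<Prod>k<q. Gamma ((1 + real k) / real q))"
  define s where "s = 1 / real q"
  \<comment> \<open>Gauss's formula at \<open>1 + r\<close> with \<open>q\<close> factors and at
    \<open>1 + p / q * r\<close> with \<open>p\<close> factors yields the same shift
    \<open>s * r\<close>, so a factor of \<open>N\<close> and one of \<open>D\<close> form a
    quotient of the Beta type. Indices start at 0, hence the numerators
    \<open>1 + k\<close>.\<close>
  define N where "N = (\<lambda>r k. Gamma ((1 + real k) / real q + s * real r))"
  define D where "D = (\<lambda>r k. Gamma ((1 + real k) / real p + s * real r))"
  have q0: "q > 0" using p q by simp
  have Cp: "Cp > 0"
    unfolding Cp_def using p by (intro prod_pos Gamma_real_pos) auto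
  have Cq: "Cq > 0"
    unfolding Cq_def using q0 by (intro prod_pos Gamma_real_pos) auto
  have fact_eq: "fact r = real q ^ r * (\<Prod>k<q. N r k) / Cq" for r
  proof -
    have "fact r = Gamma (1 + real r)"
      by (simp add: Gamma_fact)
    also have "\<dots> = real q powr real r * (\<Prod>k<q. Gamma ((1 + real r + real k) / real q)) / Cq"
      using q0 by (subst Gamma_multiplication_real[of q]) (simp_all add: Cq_def)
    also have "(\<lambda>k. Gamma ((1 + real r + real k) / real q)) = N r"
      by (simp add: N_def s_def fun_eq_iff add_divide_distrib add_ac)
    finally show ?thesis
      using q0 by (simp add: powr_realpow)
  qed
  have Gamma_eq: "Gamma (1 + real p / real q * real r) =
      (real p powr (real p / real q)) ^ r * (\<Prod>k<p. D r k) / Cp" for r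
  proof -
    have "Gamma (1 + real p / real q * real r) = real p powr (real p / real q * real r) *
        (\<Prod>k<p. Gamma ((1 + real p / real q * real r + real k) / real p)) / Cp"
      using p by (subst Gamma_multiplication_real[of p]) (simp_all add: Cp_def add_pos_nonneg)
    also have "(\<lambda>k. Gamma ((1 + real p / real q * real r + real k) / real p)) = D r"
      using p by (simp add: D_def s_def fun_eq_iff add_divide_distrib add_ac)
    also have "real p powr (real p / real q * real r) = (real p powr (real p / real q)) ^ r"
      using p by (subst powr_powr[symmetric]) (simp add: powr_realpow)
    finally show ?thesis .
  qed
  \<comment> \<open>As \<open>k\<close> runs below \<open>2 * p\<close>, \<open>k div 2\<close>
    takes each value below \<open>p\<close> twice; the square thus becomes a product indexed like
    the paired part of the numerator.\<close>
  have D2: "(\<Prod>k<p. D r k) ^ 2 = (\<Prod>k<2*p. D r (k div 2))" for r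
    by (induction p) (simp_all add: power_mult_distrib power2_eq_square mult_ac)
  have N_split: "(\<Prod>k<q. N r k) = (\<Prod>k<2*p. N r k) * (\<Prod>k\<in>{2*p..<q}. N r k)" for r
    using q by (subst prod.union_disjoint[symmetric]) (auto intro!: prod.cong)
  \<comment> \<open>The ratio of the geometric factors: \<open>q\<close> from the factorial, the
    squared power of \<open>p\<close> from the squared Gamma.\<close>
  define A where "A = real q / (real p powr (real p / real q)) ^ 2"
  have "stieltjes_moment_seq (\<lambda>r. (Cp ^ 2 / Cq * A ^ r) *
      ((\<Prod>k<2*p. N r k / D r (k div 2)) * (\<Prod>k\<in>{2*p..<q}. N r k)))"
  proof (rule stieltjes_moment_seq_mult[OF _ stieltjes_moment_seq_mult[OF
          stieltjes_moment_seq_prod stieltjes_moment_seq_prod]])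
    show "stieltjes_moment_seq (\<lambda>r. Cp ^ 2 / Cq * A ^ r)"
      using Cq by (intro stieltjes_moment_seq_geometric) (simp_all add: A_def)
    show "stieltjes_moment_seq (\<lambda>r. N r k)" for k
      unfolding N_def s_def using q0 by (intro stieltjes_moment_seq_Gamma) auto
    show "stieltjes_moment_seq (\<lambda>r. N r k / D r (k div 2))" for k
    proof -
      \<comment> \<open>The ceiling estimate in zero-based form. Multiplied by \<open>p\<close> and
        combined with \<open>2 * p \<le> q\<close>, it orders the two parameters as the Beta
        quotient requires.\<close>
      have "1 + k \<le> (1 + k div 2) * 2"
        by presburger
      from mult_right_mono[OF this, of p] have "(1 + k) * p \<le> (1 + k div 2) * (2 * p)"
        by (simp only: mult.assoc)
      also have "\<dots> \<le> (1 + k div 2) * q"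
        using q by (intro mult_left_mono) auto
      finally have "real ((1 + k) * p) \<le> real ((1 + k div 2) * q)"
        by (rule of_nat_mono)
      then have "(1 + real k) / real q \<le> (1 + real (k div 2)) / real p"
        using p q0 by (simp add: divide_simps) (simp add: algebra_simps)
      then show ?thesis
        unfolding N_def D_def s_def using q0
        by (intro stieltjes_moment_seq_Gamma_ratio) auto
    qed
  qed auto
  moreover have "(Cp ^ 2 / Cq * A ^ r) *
      ((\<Prod>k<2*p. N r k / D r (k div 2)) * (\<Prod>k\<in>{2*p..<q}. N r k))
      = fact r / Gamma (1 + real p / real q * real r) ^ 2" for r
  proof -
    have Gamma2_eq: "Gamma (1 + real p / real q * real r) ^ 2 =
        ((real p powr (real p / real q)) ^ 2) ^ r * (\<Prod>k<2*p. D r (k div 2)) / Cp ^ 2"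
      unfolding Gamma_eq power_divide power_mult_distrib D2
      by (simp only: mult.commute flip: power_mult)
    show ?thesis
      unfolding Gamma2_eq fact_eq A_def N_split
      by (simp add: power_divide prod_dividef mult_ac)
  qed
  ultimately show ?thesis by simp
qed

section \<open>From moments to complete monotonicity\<close>

text \<open>Up to the sign \<open>(- 1) ^ j\<close>, the \<open>j\<close>-th derivative at
  \<open>x\<close> is the integral of \<open>t ^ j * exp (- x * t)\<close> against the moment
  measure. Convergence of the series at every real point justifies both termwise differentiation and
  the interchange of sum and integral.\<close>

lemma completely_monotone_moment_series:
  fixes m :: "nat \<Rightarrow> real"
  assumes m: "stieltjes_moment_seq m"
    and summ: "\<And>y :: real. summable (\<lambda>r. m r / fact r * y ^ r)"
  shows "completely_monotone (\<lambda>x. \<Sum>r. m r / fact r * (- x) ^ r)"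
proof -
  \<comment> \<open>\<open>c j\<close> holds the power series coefficients at 0 of the
    \<open>j\<close>-th derivative.\<close>
  define c where "c = (\<lambda>j r. (- 1) ^ (r + j) * m (r + j) / fact r)"
  define f where "f = (\<lambda>x. \<Sum>r. m r / fact r * (- x) ^ r)"
  have diffs_c: "diffs (c j) = c (Suc j)" for j
    by (simp add: diffs_def c_def fun_eq_iff fact_Suc del: of_nat_Suc)
  have sign: "m r / fact r * (- y) ^ r = c 0 r * y ^ r" for r and y :: real
    by (simp add: c_def power_minus[of y] field_simps)
  have summ_c: "summable (\<lambda>r. c j r * y ^ r)" for j and y :: real
  proof (induction j arbitrary: y)
    case 0
    then show ?case using summ[of "- y"] by (simp only: sign)
  next
    case (Suc j)
    show ?case
      unfolding diffs_c[symmetric] by (rule termdiff_converges_all) (rule Suc)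
  qed
  have deriv_c: "((\<lambda>x. \<Sum>r. c j r * x ^ r) has_field_derivative (\<Sum>r. c (Suc j) r * x ^ r)) (at x)" for j x
    unfolding diffs_c[symmetric] by (rule termdiffs_strong_converges_everywhere) (rule summ_c)
  have deriv_f: "(deriv ^^ j) f = (\<lambda>x. \<Sum>r. c j r * x ^ r)" for j
  proof (induction j)
    case 0
    then show ?case unfolding f_def sign by simp
  next
    case (Suc j)
    show ?case using DERIV_imp_deriv[OF deriv_c] by (simp add: Suc fun_eq_iff)
  qed
  obtain M where M: "sets M = sets borel" "AE t in M. 0 \<le> t" "\<And>n. 0 \<le> m n"
      "\<And>n. (\<integral>\<^sup>+t. ennreal (t ^ n) \<partial>M) = ennreal (m n)"
    using m unfolding stieltjes_moment_seq_def by blast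
  note [measurable_cong] = M(1)
  have moment: "integrable M (\<lambda>t. t ^ n)" "(\<integral>t. t ^ n \<partial>M) = m n" for n
  proof -
    have "AE t in M. 0 \<le> t ^ n"
      using M(2) by (auto elim!: eventually_mono)
    then show "integrable M (\<lambda>t. t ^ n)" "(\<integral>t. t ^ n \<partial>M) = m n"
      using nn_integral_eq_integrable[of "\<lambda>t. t ^ n" M "m n"] M(3,4) by auto
  qed
  have "(- 1) ^ j * (deriv ^^ j) f x \<ge> 0" if x: "x > 0" for j x
  proof -
    \<comment> \<open>The terms of the expansion of \<open>t ^ j * exp (- x * t)\<close>; the
      integral of \<open>g r\<close> is \<open>(- 1) ^ j * (c j r * x ^ r)\<close>.\<close>
    define g where "g = (\<lambda>r t. (- x) ^ r / fact r * t ^ (r + j))"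
    have g_sums: "(\<lambda>r. g r t) sums (t ^ j * exp (- x * t))" for t
    proof -
      have "(\<lambda>r. t ^ j * ((- x * t) ^ r /\<^sub>R fact r)) sums (t ^ j * exp (- x * t))"
        by (intro sums_mult exp_converges)
      moreover have "t ^ j * ((- x * t) ^ r /\<^sub>R fact r) = g r t" for r
        by (simp only: g_def power_mult_distrib power_add) (simp add: field_simps)
      ultimately show ?thesis by simp
    qed
    have norm_g: "norm (g r t) = x ^ r / fact r * \<bar>t\<bar> ^ (r + j)" for r t
      using x by (simp add: g_def abs_mult power_abs)
    have summable_norm: "summable (\<lambda>r. norm (g r t))" for t
    proof -
      have "summable (\<lambda>r. \<bar>t\<bar> ^ j * ((x * \<bar>t\<bar>) ^ r /\<^sub>R fact r))"
        by (intro summable_mult summable_exp_generic)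
      moreover have "\<bar>t\<bar> ^ j * ((x * \<bar>t\<bar>) ^ r /\<^sub>R fact r) = norm (g r t)" for r
        by (simp only: norm_g power_mult_distrib power_add) (simp add: field_simps)
      ultimately show ?thesis by (simp only:)
    qed
    have "AE t in M. x ^ r / fact r * \<bar>t\<bar> ^ (r + j) = x ^ r / fact r * t ^ (r + j)" for r
      using M(2) by (rule eventually_mono) simp
    then have "(\<integral>t. norm (g r t) \<partial>M) = (\<integral>t. x ^ r / fact r * t ^ (r + j) \<partial>M)" for r
      unfolding norm_g by (intro integral_cong_AE) auto
    then have int_norm: "(\<integral>t. norm (g r t) \<partial>M) = x ^ r / fact r * m (r + j)" for r
      by (simp add: moment)
    have c_eq: "(- 1) ^ j * (c j r * y ^ r) = (- y) ^ r / fact r * m (r + j)" for r and y :: real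
      by (cases "even j"; cases "even r") (simp_all add: c_def)
    \<comment> \<open>At \<open>- x\<close> all terms of the signed derivative series are
      nonnegative and coincide with the integrals of the norms, so convergence there gives the
      domination needed for the interchange.\<close>
    have "summable (\<lambda>r. (- 1) ^ j * (c j r * (- x) ^ r))"
      by (intro summable_mult summ_c)
    then have summable_int: "summable (\<lambda>r. \<integral>t. norm (g r t) \<partial>M)"
      unfolding int_norm c_eq by simp
    have "(- 1) ^ j * (deriv ^^ j) f x = (\<Sum>r. (- 1) ^ j * (c j r * x ^ r))"
      unfolding deriv_f by (rule suminf_mult[symmetric]) (rule summ_c)
    also have "\<dots> = (\<Sum>r. \<integral>t. g r t \<partial>M)"
      by (rule suminf_cong) (simp add: c_eq g_def moment)
    also have "\<dots> = (\<integral>t. (\<Sum>r. g r t) \<partial>M)"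
      using summable_norm summable_int
      by (intro integral_suminf[symmetric]) (auto simp: g_def moment)
    also have "\<dots> = (\<integral>t. t ^ j * exp (- x * t) \<partial>M)"
      by (simp add: sums_unique[OF g_sums, symmetric])
    also have "\<dots> \<ge> 0"
      using M(2) by (intro integral_nonneg_AE) (auto elim!: eventually_mono)
    finally show ?thesis .
  qed
  moreover have "(deriv ^^ j) f differentiable (at x)" for j x
    unfolding deriv_f using deriv_c by (blast intro: differentiableI[OF has_field_derivative_imp_has_derivative])
  ultimately show ?thesis
    unfolding completely_monotone_def f_def by blast
qed

section \<open>Growth of Gamma and convergence of the series\<close>

text \<open>Only the part of Euler's integral over \<open>t \<ge> K\<close> is kept, where
  \<open>t powr s \<ge> K powr s\<close>. As \<open>K\<close> is free, Gamma outgrows every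
  exponential in \<open>s\<close>.\<close>

lemma Gamma_ge_powr:
  fixes s K :: real
  assumes s: "s \<ge> 0" and K: "K > 0"
  shows "K powr s * exp (- K) \<le> Gamma (1 + s)"
proof -
  have *: "((\<lambda>t. t powr s / exp t) has_integral Gamma (1 + s)) {0..}"
    using Gamma_integral_real[of "1 + s"] s by simp
  have "((\<lambda>t. exp (- 1 * t)) has_integral exp (- 1 * K) / 1) {K..}"
    by (rule has_integral_exp_minus_to_infinity) simp
  then have "((\<lambda>t. K powr s * exp (- t)) has_integral K powr s * exp (- K)) {K..}"
    by (intro has_integral_mult_right) simp
  \<comment> \<open>Extension by 0 puts both integrals on the same domain for a pointwise
    comparison.\<close>
  then have "((\<lambda>t. if t \<in> {K..} then K powr s * exp (- t) else 0) has_integral K powr s * exp (- K)) {0..}"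
    using K by (subst has_integral_restrict) auto
  then show ?thesis
    by (rule has_integral_le[OF _ *])
       (use s K in \<open>auto simp: exp_minus divide_inverse intro!: mult_right_mono powr_mono2\<close>)
qed

lemma summable_power_div_Gamma_power2:
  fixes \<alpha> y :: real
  assumes \<alpha>: "\<alpha> > 0"
  shows "summable (\<lambda>r. y ^ r / Gamma (1 + \<alpha> * real r) ^ 2)"
proof -
  \<comment> \<open>\<open>K\<close> solves \<open>K powr (2 * \<alpha>) = L\<close>, so the squared
    lower bound for Gamma is \<open>L ^ r\<close> up to a constant. The choice of \<open>L\<close>
    gives a geometric majorant of ratio below 1/2, and the added 1 keeps \<open>L\<close> positive
    at \<open>y = 0\<close>.\<close>
  define L where "L = 2 * \<bar>y\<bar> + 1"
  define K where "K = L powr (1 / (2 * \<alpha>))"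
  have L: "L > 0" by (simp add: L_def)
  then have K: "K > 0" by (simp add: K_def)
  have "norm (y ^ r / Gamma (1 + \<alpha> * real r) ^ 2) \<le> exp K ^ 2 * (\<bar>y\<bar> / L) ^ r" for r
  proof -
    have "K powr (\<alpha> * real r) * exp (- K) \<le> Gamma (1 + \<alpha> * real r)"
      using \<alpha> K by (intro Gamma_ge_powr) auto
    then have "(K powr (\<alpha> * real r) * exp (- K)) ^ 2 \<le> Gamma (1 + \<alpha> * real r) ^ 2"
      by (intro power_mono) auto
    moreover have "(K powr (\<alpha> * real r)) ^ 2 = L ^ r"
    proof -
      have "(K powr (\<alpha> * real r)) ^ 2 = K powr (\<alpha> * real r * 2)"
        using K by (simp add: powr_powr flip: powr_realpow)
      also have "\<dots> = L powr real r"
        using \<alpha> by (simp add: K_def powr_powr)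
      finally show ?thesis using L by (simp add: powr_realpow)
    qed
    ultimately have le: "L ^ r / exp K ^ 2 \<le> Gamma (1 + \<alpha> * real r) ^ 2"
      by (simp add: power_mult_distrib exp_minus power_inverse divide_inverse)
    have pos: "L ^ r / exp K ^ 2 > 0" using L by simp
    then have Gamma_pos: "Gamma (1 + \<alpha> * real r) ^ 2 > 0"
      using le by (rule less_le_trans)
    have "\<bar>y\<bar> ^ r / Gamma (1 + \<alpha> * real r) ^ 2 \<le> \<bar>y\<bar> ^ r / (L ^ r / exp K ^ 2)"
      by (rule divide_left_mono[OF le _ mult_pos_pos[OF Gamma_pos pos]]) simp
    then show ?thesis
      by (simp add: power_abs power_divide mult_ac)
  qed
  moreover have "summable (\<lambda>r. exp K ^ 2 * (\<bar>y\<bar> / L) ^ r)"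
    using L by (intro summable_mult summable_geometric) (simp add: L_def)
  ultimately show ?thesis
    by (rule summable_comparison_test'[where N = 0, rotated])
qed

theorem mainTheorem3:
  fixes \<alpha> :: real
  assumes "\<alpha> \<in> \<rat>" and "0 < \<alpha>" and "\<alpha> \<le> 1 / 2"
  shows "completely_monotone (\<lambda>x. le_roy_ML 2 \<alpha> 1 (- x))"
proof -
  obtain p q :: nat where q: "q \<noteq> 0" and \<alpha>: "\<bar>\<alpha>\<bar> = real p / real q"
    using Rats_abs_nat_div_natE[OF assms(1)] by metis
  then have \<alpha>: "\<alpha> = real p / real q" using assms by simp
  have "p > 0" using assms(2) \<alpha> by (cases p) auto
  moreover have "2 * p \<le> q"
    using assms(3) q by (simp add: \<alpha> field_simps flip: of_nat_mult)
  ultimately have "stieltjes_moment_seq (\<lambda>r. fact r / Gamma (1 + \<alpha> * real r) ^ 2)"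
    unfolding \<alpha> by (rule stieltjes_moment_seq_fact_div_Gamma_power2)
  \<comment> \<open>The factor \<open>fact r\<close> in the moments cancels the factorial of the
    exponential series and leaves the Le Roy coefficients.\<close>
  then have "completely_monotone
      (\<lambda>x. \<Sum>r. fact r / Gamma (1 + \<alpha> * real r) ^ 2 / fact r * (- x) ^ r)"
    by (rule completely_monotone_moment_series)
       (use summable_power_div_Gamma_power2[OF assms(2)] in simp)
  then show ?thesis
    by (simp add: le_roy_ML_def)
qed

end
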